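(* Consider a degenerate linear program with 4 variables and 2 constraints, $$\text{maximize } z=\sum_{j=1}^4c_jx_j\quad\text{subject to}\quad \sum_{j=1}^4N_{ij}x_j\le 0\ (i=1,2),\qquad x_j\ge 0,$$ with initial tableau $M^{(1)}$ (a $3\times 6$ matrix) whose upper-left $2\times2$ block is $A=(A_{ij})$, normalized so that the objective row has first entry $-1$ and second entry $\mu$, and so that $A_{21}<0<A_{12}$. Assume that the most negative reduced cost column selection rule and the largest pivot row degeneracy tie-breaking rule are used. Then the problem has the 2/6-cycle pattern and cycles indefinitely if and only if all of the following hold: (i) $$M^{(1)}=\begin{bmatrix} A_{11} & A_{12} & -(A_{11}+1) & -A_{12} & 1 & 0\\ A_{21} & -(A_{11}+1) & -A_{21} & A_{11} & 0 & 1\\ -1 & \mu & -(A_{11}+1)+\mu A_{21} & -A_{12}-\mu A_{11} & 0 & 0\end{bmatrix}\quad\text{and}\quad -A_{21}A_{12}=1+A_{11}+A_{11}^2;$$ (ii) $0<A_{11}$ and $0<A_{12}<1$; (iii) $$-1<\mu<-\frac{A_{12}(A_{11}+2)}{A_{11}(A_{11}+1)}$$ (which implies $A_{12}<A_{11}\left(\frac{A_{11}+1}{A_{11}+2}\right)$).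
   Context: Slack variables $x_5,x_6$ are added to constraints 1 and 2 and form the initial basis; the objective is written as the row $z-\sum_jc_jx_j=0$. $M^{(n)}$ denotes the $3\times6$ matrix of coefficients of $x_1,\dots,x_6$ in the two constraint rows (rows 1, 2) and the objective row (row 3) at the start of iteration $n$; thus $M^{(1)}=\begin{bmatrix}N&I\\-c^T&0\end{bmatrix}$. All right-hand sides are and remain $0$. Each iteration is a simplex (Gauss-Jordan) pivot. Column selection (most negative reduced cost): the entering column is the one with the most negative entry in row 3; if no entry is negative the method stops. If this rule does not determine the column uniquely, a choice is assumed to be made which breaks the 2/6-cycle pattern. Row selection (largest pivot): the candidates are the constraint rows with strictly positive entry in the entering column (all ratios are $0$, so all candidates tie in the ratio test); the candidate with the largest entry is chosen, and if a tie remains row 1 is chosen. If there is no candidate the problem is unbounded and the method stops. 2/6-cycle pattern: in iteration $n=1,2,3,\dots$ the pivot is in column $n$ (column indices taken modulo 6 in $\{1,\dots,6\}$), in row 1 if $n$ is odd and in row 2 if $n$ is even, and the coefficients repeat after two iterations, meaning that $M^{(3)}$ equals $M^{(1)}$ with its columns shifted cyclically two places to the right (hence $M^{(7)}=M^{(1)}$ and the method cycles with cycle length 6). Normalizations: since column 1 enters first it has a negative objective row entry, and positive scaling of the objective row is immaterial, so that entry is scaled to $-1$. In a 2/6-cycle example $A_{12}$ and $A_{21}$ have opposite signs, and the case $A_{21}>0$ corresponds to the case $A_{21}<0$ after shifting the columns cyclically by one place and interchanging the two rows, so $A_{21}<0<A_{12}$ is taken as a convention. *)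

theory Defs
  imports "HOL-Analysis.Analysis"
begin

text \<open>
  Tableaux are indexed by the finite types \<open>3\<close> (rows) and \<open>6\<close> (columns), whose arithmetic is
  modulo 3 and modulo 6. Rows 1 and 2 are the constraint rows, row \<open>3 = 0\<close> is the objective row;
  the columns are \<open>1, \<dots>, 5, 6 = 0\<close>. So \<open>of_nat n :: 6\<close> is the column \<open>n\<close> taken modulo 6, and
  \<open>j - 2\<close> is a cyclic shift. The order on these index types, in which 6 precedes 1, is not used.
  The right-hand sides are constantly 0 and are not part of a tableau.
\<close>

type_synonym tableau = "real ^ 6 ^ 3"

definition initial_tableau :: "real ^ 4 ^ 2 \<Rightarrow> real ^ 4 \<Rightarrow> tableau" where
  "initial_tableau N c = vector
     [vector [N $ 1 $ 1, N $ 1 $ 2, N $ 1 $ 3, N $ 1 $ 4, 1, 0],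
      vector [N $ 2 $ 1, N $ 2 $ 2, N $ 2 $ 3, N $ 2 $ 4, 0, 1],
      vector [- (c $ 1), - (c $ 2), - (c $ 3), - (c $ 4), 0, 0]]"

definition pivot :: "tableau \<Rightarrow> 3 \<Rightarrow> 6 \<Rightarrow> tableau" where
  "pivot M r s = (\<chi> i j. if i = r then M $ r $ j / M $ r $ s
                          else M $ i $ j - M $ i $ s * (M $ r $ j / M $ r $ s))"

text \<open>
  A column choice \<open>col\<close> gives the entering column \<open>col n M\<close> for tableau \<open>M\<close> in iteration \<open>n\<close>.
  The last conjunct says that ties for the most negative entry are broken against the
  2/6-cycle pattern, in which column \<open>n\<close> (modulo 6) enters in iteration \<open>n\<close>.
\<close>

definition most_negative_rule :: "(nat \<Rightarrow> tableau \<Rightarrow> 6) \<Rightarrow> bool" where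
  "most_negative_rule col \<longleftrightarrow>
     (\<forall>n M. (\<exists>j. M $ 3 $ j < 0) \<longrightarrow>
        (\<forall>j. M $ 3 $ col n M \<le> M $ 3 $ j) \<and>
        ((\<exists>j. j \<noteq> col n M \<and> M $ 3 $ j = M $ 3 $ col n M) \<longrightarrow> col n M \<noteq> of_nat n))"

definition candidate_rows :: "tableau \<Rightarrow> 6 \<Rightarrow> 3 set" where
  "candidate_rows M s = {i. i \<in> {1, 2} \<and> 0 < M $ i $ s}"

text \<open>Only meaningful if there is at least one candidate row.\<close>

definition largest_pivot_row :: "tableau \<Rightarrow> 6 \<Rightarrow> 3" where
  "largest_pivot_row M s =
     (if 1 \<in> candidate_rows M s \<and> (\<forall>i\<in>candidate_rows M s. M $ i $ s \<le> M $ 1 $ s)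
      then 1 else 2)"

text \<open>The pivot (row, column) of iteration \<open>n\<close>; \<open>None\<close> means that the algorithm stops.\<close>

definition pivot_position :: "(nat \<Rightarrow> tableau \<Rightarrow> 6) \<Rightarrow> nat \<Rightarrow> tableau \<Rightarrow> (3 \<times> 6) option" where
  "pivot_position col n M =
     (if (\<forall>j. 0 \<le> M $ 3 $ j) \<or> candidate_rows M (col n M) = {} then None
      else Some (largest_pivot_row M (col n M), col n M))"

definition iteration :: "(nat \<Rightarrow> tableau \<Rightarrow> 6) \<Rightarrow> nat \<Rightarrow> tableau \<Rightarrow> tableau option" where
  "iteration col n M = map_option (\<lambda>(r, s). pivot M r s) (pivot_position col n M)"

primrec after_iterations ::
  "(nat \<Rightarrow> tableau \<Rightarrow> 6) \<Rightarrow> real ^ 4 ^ 2 \<Rightarrow> real ^ 4 \<Rightarrow> nat \<Rightarrow> tableau option" where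
  "after_iterations col N c 0 = Some (initial_tableau N c)"
| "after_iterations col N c (Suc k) =
     Option.bind (after_iterations col N c k) (iteration col (Suc k))"

text \<open>The tableau at the start of iteration \<open>n \<ge> 1\<close>, if iteration \<open>n\<close> is reached.\<close>

definition tableau_at ::
  "(nat \<Rightarrow> tableau \<Rightarrow> 6) \<Rightarrow> real ^ 4 ^ 2 \<Rightarrow> real ^ 4 \<Rightarrow> nat \<Rightarrow> tableau option" where
  "tableau_at col N c n = after_iterations col N c (n - 1)"

definition has_2_6_cycle_pattern ::
  "(nat \<Rightarrow> tableau \<Rightarrow> 6) \<Rightarrow> real ^ 4 ^ 2 \<Rightarrow> real ^ 4 \<Rightarrow> bool" where
  "has_2_6_cycle_pattern col N c \<longleftrightarrow>
     (\<forall>n\<ge>1. \<exists>M. tableau_at col N c n = Some M \<and>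
        pivot_position col n M = Some (if odd n then 1 else 2, of_nat n)) \<and>
     (\<exists>M1 M3. tableau_at col N c 1 = Some M1 \<and> tableau_at col N c 3 = Some M3 \<and>
        (\<forall>i j. M3 $ i $ j = M1 $ i $ (j - 2)))"

definition cycles_indefinitely ::
  "(nat \<Rightarrow> tableau \<Rightarrow> 6) \<Rightarrow> real ^ 4 ^ 2 \<Rightarrow> real ^ 4 \<Rightarrow> bool" where
  "cycles_indefinitely col N c \<longleftrightarrow>
     (\<exists>p>0. \<forall>n\<ge>1. tableau_at col N c n \<noteq> None \<and>
        tableau_at col N c (n + p) = tableau_at col N c n)"

end

theory Submission
  imports Defs
begin

text \<open>
  A simplex pivot commutes with cyclic shifts of the columns, so the 2/6-cycle pattern only
  concerns the first two iterations. Write the constraint rows of the initial tableau as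
  \<open>[A C I]\<close>. Two pivots on the columns of \<open>A\<close> turn them into \<open>[I A\<inverse>C A\<inverse>]\<close>, and this is
  the shifted tableau iff \<open>C = A\<inverse>\<close> and \<open>A\<^sup>3 = I\<close>. As \<open>A\<close> is not a multiple of \<open>I\<close>, the latter
  means that \<open>A\<close> has trace \<open>-1\<close> and determinant \<open>1\<close>. Of the inequalities expressing that the two
  pivot positions are selected, those in (ii) and (iii) imply all others.
\<close>

section \<open>Columns as elements of the finite type \<open>6\<close>\<close>

lemma exhaust_6:
  fixes x :: 6
  shows "x = 1 \<or> x = 2 \<or> x = 3 \<or> x = 4 \<or> x = 5 \<or> x = 6"
proof (induct x)
  case (of_int z)
  then have "0 \<le> z" and "z < 6" by simp_all
  then have "z = 0 \<or> z = 1 \<or> z = 2 \<or> z = 3 \<or> z = 4 \<or> z = 5" by arith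
  \<comment> \<open>The case \<open>z = 0\<close> is column 6, because \<open>6 = 0\<close> in this
    type.\<close>
  then show ?case by auto
qed

lemma forall_6: "(\<forall>i::6. P i) \<longleftrightarrow> P 1 \<and> P 2 \<and> P 3 \<and> P 4 \<and> P 5 \<and> P 6"
  by (metis exhaust_6)

text \<open>The last two equations serve shifted indices such as \<open>2 - 2\<close> and
  \<open>1 - 2\<close>, which simplify to \<open>0\<close> and \<open>- 1\<close>.\<close>

lemma vector_6:
  "(vector [a,b,c,d,e,f] :: 'a::zero^6) $ 1 = a"
  "(vector [a,b,c,d,e,f] :: 'a::zero^6) $ 2 = b"
  "(vector [a,b,c,d,e,f] :: 'a::zero^6) $ 3 = c"
  "(vector [a,b,c,d,e,f] :: 'a::zero^6) $ 4 = d"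
  "(vector [a,b,c,d,e,f] :: 'a::zero^6) $ 5 = e"
  "(vector [a,b,c,d,e,f] :: 'a::zero^6) $ 6 = f"
  "(vector [a,b,c,d,e,f] :: 'a::zero^6) $ 0 = f"
  "(vector [a,b,c,d,e,f] :: 'a::zero^6) $ (- 1) = e"
  by (simp_all add: vector_def)

section \<open>Pivot selection as a system of inequalities\<close>

text \<open>This form is free of the column choice. Ties in the objective row are broken against the
  pattern, so the pattern column enters only as a strict minimum. The asymmetry between
  \<open>\<le>\<close> and \<open><\<close> records that row 1 wins ties between rows.\<close>

definition unique_pivot :: "tableau \<Rightarrow> 3 \<Rightarrow> 6 \<Rightarrow> bool" where
  "unique_pivot M r s \<longleftrightarrow>
     M $ 3 $ s < 0 \<and> (\<forall>j. j \<noteq> s \<longrightarrow> M $ 3 $ s < M $ 3 $ j) \<and>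
     (r = 1 \<and> 0 < M $ 1 $ s \<and> M $ 2 $ s \<le> M $ 1 $ s \<or>
      r = 2 \<and> 0 < M $ 2 $ s \<and> M $ 1 $ s < M $ 2 $ s)"

lemma pivot_position_eq_Some_iff:
  assumes rule: "most_negative_rule col"
  shows "pivot_position col n M = Some (r, of_nat n) \<longleftrightarrow> unique_pivot M r (of_nat n)"
proof
  assume pos: "pivot_position col n M = Some (r, of_nat n)"
  then have neg: "\<exists>j. M $ 3 $ j < 0" and cand: "candidate_rows M (of_nat n) \<noteq> {}"
    and col: "col n M = of_nat n" and r: "r = largest_pivot_row M (of_nat n)"
    by (auto simp: pivot_position_def not_le split: if_splits)
  have le: "\<forall>j. M $ 3 $ of_nat n \<le> M $ 3 $ j"
    and uniq: "\<forall>j. j \<noteq> of_nat n \<longrightarrow> M $ 3 $ j \<noteq> M $ 3 $ of_nat n"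
    using rule neg col unfolding most_negative_rule_def by metis+
  from neg le have "M $ 3 $ of_nat n < 0"
    by (meson le_less_trans)
  moreover have "\<forall>j. j \<noteq> of_nat n \<longrightarrow> M $ 3 $ of_nat n < M $ 3 $ j"
    using le uniq by (metis order_le_less)
  ultimately show "unique_pivot M r (of_nat n)"
    using cand r
    by (auto simp: unique_pivot_def largest_pivot_row_def candidate_rows_def split: if_splits)
next
  assume up: "unique_pivot M r (of_nat n)"
  then have neg: "\<exists>j. M $ 3 $ j < 0" by (auto simp: unique_pivot_def)
  then have "M $ 3 $ col n M \<le> M $ 3 $ of_nat n"
    using rule unfolding most_negative_rule_def by metis
  with up have col: "col n M = of_nat n"
    unfolding unique_pivot_def by (meson not_le)
  from up have "candidate_rows M (of_nat n) \<noteq> {}" "r = largest_pivot_row M (of_nat n)"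
    by (auto simp: unique_pivot_def largest_pivot_row_def candidate_rows_def)
  with neg col show "pivot_position col n M = Some (r, of_nat n)"
    by (auto simp: pivot_position_def not_le)
qed

lemma iteration_unique_pivot:
  assumes "most_negative_rule col" and "unique_pivot M r (of_nat n)"
  shows "iteration col n M = Some (pivot M r (of_nat n))"
  using assms pivot_position_eq_Some_iff[of col n M r] by (simp add: iteration_def)

section \<open>Cyclic shifts and reduction to two iterations\<close>

definition shift_columns :: "6 \<Rightarrow> tableau \<Rightarrow> tableau" where
  "shift_columns k M = (\<chi> i j. M $ i $ (j - k))"

lemma shift_columns_nth [simp]: "shift_columns k M $ i $ j = M $ i $ (j - k)"
  by (simp add: shift_columns_def)

lemma shift_columns_0 [simp]: "shift_columns 0 M = M"
  by (simp add: vec_eq_iff)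

lemma shift_columns_shift_columns: "shift_columns k (shift_columns l M) = shift_columns (k + l) M"
  by (simp add: vec_eq_iff algebra_simps)

lemma pivot_shift_columns: "pivot (shift_columns k M) r s = shift_columns k (pivot M r (s - k))"
  by (simp add: vec_eq_iff pivot_def)

lemma unique_pivot_shift_columns:
  "unique_pivot (shift_columns k M) r s \<longleftrightarrow> unique_pivot M r (s - k)"
proof -
  have "(\<forall>j. j \<noteq> s \<longrightarrow> x < M $ 3 $ (j - k)) \<longleftrightarrow> (\<forall>j. j \<noteq> s - k \<longrightarrow> x < M $ 3 $ j)" for x
    by (metis add_diff_cancel diff_add_cancel)
  then show ?thesis by (simp add: unique_pivot_def)
qed

text \<open>Every pair of iterations repeats the first pair on a shifted tableau: after a shift by
  \<open>2 * k\<close>, the columns of the next two iterations correspond to columns 1 and 2 of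
  \<open>T\<close>.\<close>

lemma after_iterations_shift:
  fixes N c
  defines "T \<equiv> initial_tableau N c"
  assumes rule: "most_negative_rule col"
    and p1: "unique_pivot T 1 1"
    and p2: "unique_pivot (pivot T 1 1) 2 2"
    and sh: "pivot (pivot T 1 1) 2 2 = shift_columns 2 T"
  shows "after_iterations col N c (2 * k) = Some (shift_columns (of_nat (2 * k)) T)"
    and "after_iterations col N c (Suc (2 * k)) = Some (shift_columns (of_nat (2 * k)) (pivot T 1 1))"
proof -
  have odd: "iteration col (Suc (2 * k)) (shift_columns (of_nat (2 * k)) T)
      = Some (shift_columns (of_nat (2 * k)) (pivot T 1 1))" for k
    using iteration_unique_pivot[OF rule, of "shift_columns (of_nat (2 * k)) T" 1 "Suc (2 * k)"] p1
    by (simp add: unique_pivot_shift_columns pivot_shift_columns)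
  have even: "iteration col (Suc (Suc (2 * k))) (shift_columns (of_nat (2 * k)) (pivot T 1 1))
      = Some (shift_columns (of_nat (2 * Suc k)) T)" for k
    using iteration_unique_pivot[OF rule,
        of "shift_columns (of_nat (2 * k)) (pivot T 1 1)" 2 "Suc (Suc (2 * k))"] p2 sh
    by (simp add: unique_pivot_shift_columns pivot_shift_columns shift_columns_shift_columns
        add.commute)
  show *: "after_iterations col N c (2 * k) = Some (shift_columns (of_nat (2 * k)) T)"
  proof (induction k)
    case 0
    then show ?case by (simp add: T_def)
  next
    case (Suc k)
    then show ?case using odd[of k] even[of k] by simp
  qed
  show "after_iterations col N c (Suc (2 * k)) = Some (shift_columns (of_nat (2 * k)) (pivot T 1 1))"
    using * odd[of k] by simp
qed

lemma has_2_6_cycle_pattern_iff: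
  fixes N c
  defines "T \<equiv> initial_tableau N c"
  assumes rule: "most_negative_rule col"
  shows "has_2_6_cycle_pattern col N c \<longleftrightarrow>
    unique_pivot T 1 1 \<and> unique_pivot (pivot T 1 1) 2 2 \<and>
    pivot (pivot T 1 1) 2 2 = shift_columns 2 T" (is "_ \<longleftrightarrow> ?R")
proof
  assume pat: "has_2_6_cycle_pattern col N c"
  then have pos: "\<exists>M. tableau_at col N c n = Some M \<and>
      pivot_position col n M = Some (if odd n then 1 else 2, of_nat n)" if "n \<ge> 1" for n
    using that by (auto simp: has_2_6_cycle_pattern_def)
  have p1: "unique_pivot T 1 1"
    using pos[of 1] pivot_position_eq_Some_iff[OF rule, of 1]
    by (simp add: tableau_at_def T_def)
  then have a1: "after_iterations col N c 1 = Some (pivot T 1 1)"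
    using iteration_unique_pivot[OF rule, of T 1 1] by (simp add: T_def)
  then have p2: "unique_pivot (pivot T 1 1) 2 2"
    using pos[of 2] pivot_position_eq_Some_iff[OF rule, of 2]
    by (simp add: tableau_at_def)
  then have "after_iterations col N c 2 = Some (pivot (pivot T 1 1) 2 2)"
    using a1 iteration_unique_pivot[OF rule, of "pivot T 1 1" 2 2]
    by (simp add: numeral_2_eq_2)
  with pat have "pivot (pivot T 1 1) 2 2 = shift_columns 2 T"
    by (auto simp: has_2_6_cycle_pattern_def tableau_at_def T_def vec_eq_iff)
  with p1 p2 show ?R by simp
next
  assume R: ?R
  note after = after_iterations_shift[OF rule, of N c, folded T_def,
      OF R[THEN conjunct1] R[THEN conjunct2, THEN conjunct1] R[THEN conjunct2, THEN conjunct2]]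
  have "\<exists>M. tableau_at col N c n = Some M \<and>
      pivot_position col n M = Some (if odd n then 1 else 2, of_nat n)" if n: "n \<ge> 1" for n
  proof (cases "odd n")
    case True
    then obtain k where k: "n = Suc (2 * k)" by (auto elim: oddE)
    then show ?thesis
      using after(1)[of k] R pivot_position_eq_Some_iff[OF rule, of n _ 1]
      by (simp add: tableau_at_def unique_pivot_shift_columns del: of_nat_mult)
  next
    case False
    then obtain m where "n = 2 * m" by (auto elim: evenE)
    \<comment> \<open>Even iterations are the second of their pair. Since \<open>n \<ge> 1\<close>
      gives \<open>m \<ge> 1\<close>, the subtraction \<open>m - 1\<close> does not
      truncate.\<close>
    with n have k: "n = Suc (Suc (2 * (m - 1)))" by simp
    then show ?thesis
      using after(2)[of "m - 1"] R k pivot_position_eq_Some_iff[OF rule, of n _ 2]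
      by (simp add: tableau_at_def unique_pivot_shift_columns
          del: of_nat_mult after_iterations.simps)
  qed
  moreover have "tableau_at col N c 1 = Some T" "tableau_at col N c 3 = Some (shift_columns 2 T)"
    using after(1)[of 0] after(1)[of 1] by (simp_all add: tableau_at_def T_def)
  ultimately show "has_2_6_cycle_pattern col N c"
    by (simp add: has_2_6_cycle_pattern_def)
qed

text \<open>Three shifts by two columns make a full turn, which gives the period 6.\<close>

lemma has_2_6_cycle_pattern_imp_cycles:
  assumes rule: "most_negative_rule col" and pat: "has_2_6_cycle_pattern col N c"
  shows "cycles_indefinitely col N c"
proof -
  define T where "T = initial_tableau N c"
  note R = pat[unfolded has_2_6_cycle_pattern_iff[OF rule], folded T_def]
  note after = after_iterations_shift[OF rule, of N c, folded T_def,
      OF R[THEN conjunct1] R[THEN conjunct2, THEN conjunct1] R[THEN conjunct2, THEN conjunct2]]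
  have six: "(of_nat (2 * (k + 3)) :: 6) = of_nat (2 * k)" for k
    by simp
  have "after_iterations col N c m \<noteq> None \<and>
      after_iterations col N c (m + 6) = after_iterations col N c m" for m
  proof (cases "even m")
    case True
    then obtain k where k: "m = 2 * k" by (elim evenE)
    then have k': "m + 6 = 2 * (k + 3)" by simp
    show ?thesis unfolding k' unfolding k after six by simp
  next
    case False
    then obtain k where k: "m = Suc (2 * k)" by (auto elim: oddE)
    then have k': "m + 6 = Suc (2 * (k + 3))" by simp
    show ?thesis unfolding k' unfolding k after six by simp
  qed
  \<comment> \<open>\<open>tableau_at\<close> counts from 1, so \<open>n \<ge> 1\<close> is what
    turns \<open>n + 6 - 1\<close> into \<open>(n - 1) + 6\<close>.\<close>
  then have "tableau_at col N c n \<noteq> None \<and> tableau_at col N c (n + 6) = tableau_at col N c n"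
    if "n \<ge> 1" for n
    using that by (metis Nat.add_diff_assoc2 tableau_at_def)
  then show ?thesis
    unfolding cycles_indefinitely_def by (intro exI[of _ 6]) simp
qed

section \<open>Algebra of two consecutive pivots\<close>

lemma pivot_1_1:
  fixes a b d e p q r s \<mu> v w :: real
  assumes "a \<noteq> 0"
  shows "pivot (vector [vector [a, b, p, q, 1, 0], vector [d, e, r, s, 0, 1],
                        vector [-1, \<mu>, v, w, 0, 0]]) 1 1 =
    vector [vector [1, b / a, p / a, q / a, 1 / a, 0],
            vector [0, e - d * b / a, r - d * p / a, s - d * q / a, - d / a, 1],
            vector [0, \<mu> + b / a, v + p / a, w + q / a, 1 / a, 0]]"
  using assms by (simp add: vec_eq_iff forall_3 forall_6 pivot_def vector_6)

text \<open>The second pivot element is \<open>det A / a\<close>. For trace \<open>- 1\<close> the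
  lower right entry of \<open>A\<close> is \<open>- (a + 1)\<close>, and the assumption says that
  the determinant is 1.\<close>

lemma second_pivot_element:
  fixes a b d :: real
  assumes "a \<noteq> 0" "- d * b = 1 + a + a\<^sup>2"
  shows "- (a + 1) - d * b / a = 1 / a"
  using assms by (simp add: field_simps power2_eq_square)

text \<open>
  The equations for the columns of \<open>C\<close> give \<open>C = A\<inverse>\<close>. Comparing \<open>A\<^sup>2 = A\<inverse>\<close> entrywise,
  the upper right entry (where \<open>b \<noteq> 0\<close>) and the upper left entry give \<open>trace = - 1 / det\<close> and
  \<open>trace = - det\<^sup>2\<close>, hence \<open>det = 1\<close>.
\<close>

lemma two_pivots_eq_shift_columns_iff:
  fixes a b d e p q r s \<mu> v w :: real
  defines "T \<equiv> vector [vector [a, b, p, q, 1, 0], vector [d, e, r, s, 0, 1],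
                        vector [-1, \<mu>, v, w, 0, 0]] :: tableau"
  assumes a: "a \<noteq> 0" and b: "b \<noteq> 0" and det: "e - d * b / a \<noteq> 0"
  shows "pivot (pivot T 1 1) 2 2 = shift_columns 2 T \<longleftrightarrow>
    p = - (a + 1) \<and> q = - b \<and> e = - (a + 1) \<and> r = - d \<and> s = a \<and>
    v = - (a + 1) + \<mu> * d \<and> w = - b - \<mu> * a \<and> - d * b = 1 + a + a\<^sup>2"
    (is "?L \<longleftrightarrow> ?R")
proof
  \<comment> \<open>\<open>D\<close> is the determinant of \<open>A\<close> and \<open>E\<close> the
    second pivot element.\<close>
  define D E where "D = a * e - b * d" and "E = e - d * b / a"
  have D: "D \<noteq> 0" and E: "E = D / a"
    using a det by (auto simp: D_def E_def field_simps)
  assume ?L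
  then have "pivot (pivot T 1 1) 2 2 $ i $ j = T $ i $ (j - 2)" for i j
    by simp
  note entry = this[unfolded T_def pivot_1_1[OF a] E_def[symmetric]]
  \<comment> \<open>Columns 5 and 6 of the shift identity determine \<open>C\<close> and the
    objective entries \<open>v\<close>, \<open>w\<close>; columns 3 and 4 give the equations for
    \<open>A\<close>.\<close>
  have row2: "1 / E = s" "- d / a / E = r" "(r - d * p / a) / E = d" "(s - d * q / a) / E = e"
    using entry[of 2 6] entry[of 2 5] entry[of 2 3] entry[of 2 4] a
    by (simp_all add: pivot_def vector_6)
  have "0 - b / a * (1 / E) = q" "1 / a - b / a * (- d / a / E) = p"
    "p / a - b / a * ((r - d * p / a) / E) = a" "q / a - b / a * ((s - d * q / a) / E) = b"
    "0 - (\<mu> + b / a) * (1 / E) = w" "1 / a - (\<mu> + b / a) * (- d / a / E) = v"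
    using entry[of 1 6] entry[of 1 5] entry[of 1 3] entry[of 1 4] entry[of 3 6] entry[of 3 5] a
    by (simp_all add: pivot_def vector_6)
  note eqs = this[unfolded row2]
  have s: "s = a / D" using row2(1) E by simp
  have r: "r = - d / D" using row2(2) E a by simp
  have q: "q = - b / D" using eqs(1) a D by (simp add: s field_simps)
  have p: "p = e / D"
  proof -
    have "p * (a * D) = D + b * d" using eqs(2) a D by (simp add: r field_simps)
    also have "\<dots> = e * a" by (simp add: D_def)
    finally show ?thesis using a D by (simp add: field_simps)
  qed
  have tr1: "(a + e) * D = - 1"
  proof -
    have "b * ((a + e) * D + 1) = 0" using eqs(4) a D by (simp add: q field_simps)
    then show ?thesis using b by simp
  qed
  have tr2: "a + e = - (D * D)"
  proof -
    have "e = D * (a * a + b * d)" using eqs(3) a D by (simp add: p field_simps)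
    \<comment> \<open>This is the upper left entry of the Cayley-Hamilton identity for
      \<open>A\<close>.\<close>
    also have "a * a + b * d = a * (a + e) - D" by (simp add: D_def algebra_simps)
    finally have "e = a * ((a + e) * D) - D * D" by (simp add: algebra_simps)
    then show ?thesis unfolding tr1 by simp
  qed
  have "D ^ 3 = 1" using tr1 unfolding tr2 by (simp add: power3_eq_cube)
  then have D1: "D = 1"
    using odd_real_root_power_cancel[of 3 D] by simp
  with tr1 have e: "e = - (a + 1)" by simp
  have db: "- d * b = 1 + a + a\<^sup>2"
    using D1 unfolding D_def e by (simp add: algebra_simps power2_eq_square)
  have "w = - ((\<mu> + b / a) * a)"
    using eqs(5) by (simp add: s D1)
  then have w: "w = - b - \<mu> * a"
    using a by (simp add: distrib_right)
  have "v = (1 + b * d) / a + \<mu> * d"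
    using eqs(6) a by (simp add: r D1 field_simps)
  also have "1 + b * d = - (a + 1) * a"
    using db by (simp add: algebra_simps power2_eq_square)
  finally have v: "v = - (a + 1) + \<mu> * d"
    using a by simp
  show ?R
    using p q r s e v w db D1 by simp
next
  assume R: ?R
  then have T: "T = vector [vector [a, b, - (a + 1), - b, 1, 0], vector [d, - (a + 1), - d, a, 0, 1],
      vector [-1, \<mu>, - (a + 1) + \<mu> * d, - b - \<mu> * a, 0, 0]]"
    by (simp add: T_def)
  \<comment> \<open>Oriented as a rewrite rule, this eliminates the product \<open>b * d\<close>
    from the entrywise identities.\<close>
  have bd: "b * d = - (1 + a + a * a)" and db: "- d * b = 1 + a + a\<^sup>2"
    using R by (simp_all add: algebra_simps power2_eq_square)
  show ?L
    unfolding T pivot_1_1[OF a] second_pivot_element[OF a db] using a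
    by (simp add: vec_eq_iff forall_3 forall_6 pivot_def vector_6) (simp add: field_simps bd)
qed

section \<open>Inequalities for the two selected pivots\<close>

text \<open>The first iteration supplies \<open>0 < a\<close> and \<open>- 1 < \<mu>\<close>. In the
  second, comparing the two rows gives \<open>b < 1\<close>, and comparing columns 2 and 4 of the
  objective row gives the upper bound on \<open>\<mu>\<close>. The other inequalities follow from
  these.\<close>

lemma unique_pivots_iff:
  fixes a b d \<mu> :: real
  defines "T \<equiv> vector
     [vector [a, b, - (a + 1), - b, 1, 0],
      vector [d, - (a + 1), - d, a, 0, 1],
      vector [-1, \<mu>, - (a + 1) + \<mu> * d, - b - \<mu> * a, 0, 0]] :: tableau"
  assumes b: "0 < b" and d: "d < 0" and det: "- d * b = 1 + a + a\<^sup>2"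
  shows "unique_pivot T 1 1 \<and> unique_pivot (pivot T 1 1) 2 2 \<longleftrightarrow>
    0 < a \<and> b < 1 \<and> - 1 < \<mu> \<and> \<mu> < - (b * (a + 2) / (a * (a + 1)))"
proof -
  define K where "K = b * (a + 2) / (a * (a + 1))"
  have U1: "unique_pivot T 1 1 \<longleftrightarrow>
      0 < a \<and> - 1 < \<mu> \<and> a < \<mu> * d \<and> b + \<mu> * a < 1"
    using d by (auto simp: T_def unique_pivot_def forall_6 vector_6)
  have U2: "unique_pivot (pivot T 1 1) 2 2 \<longleftrightarrow>
      \<mu> + b / a < 0 \<and> \<mu> + b / a < - (a + 1) + \<mu> * d - (a + 1) / a \<and>
      \<mu> + b / a < - b - \<mu> * a - b / a \<and> b < 1" if a: "0 < a"
  proof -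
    have "- (a + 1) - d * b / a = 1 / a"
      using second_pivot_element[OF _ det] a by simp
    moreover have "b / a < 1 / a \<longleftrightarrow> b < 1"
      using a by (simp add: divide_less_cancel)
    moreover have "\<mu> + b / a < 1 / a" if "\<mu> + b / a < 0"
      using that a by (meson less_trans zero_less_divide_1_iff)
    moreover have "(- a - 1) / a = - ((a + 1) / a)"
      by (simp add: diff_divide_distrib add_divide_distrib)
    ultimately show ?thesis
      using a pivot_1_1[of a b "- (a + 1)" "- b" d "- (a + 1)" "- d" a \<mu>]
      by (auto simp: T_def unique_pivot_def forall_6 vector_6)
  qed
  have K: "\<mu> + b / a < - b - \<mu> * a - b / a \<longleftrightarrow> \<mu> < - K" if a: "0 < a"
  proof -
    have "b * (a + 2) / a = b + 2 * (b / a)"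
      using a by (simp add: field_simps)
    then have "\<mu> + b / a < - b - \<mu> * a - b / a \<longleftrightarrow> \<mu> * (a + 1) < - (b * (a + 2) / a)"
      by (simp only:) (auto simp: algebra_simps)
    also have "\<dots> \<longleftrightarrow> \<mu> < - (b * (a + 2) / a) / (a + 1)"
      using a by (intro pos_less_divide_eq[symmetric]) simp
    also have "- (b * (a + 2) / a) / (a + 1) = - K"
      by (simp add: K_def)
    finally show ?thesis .
  qed
  have rest: "a < \<mu> * d" "b + \<mu> * a < 1" "\<mu> + b / a < 0"
      "\<mu> + b / a < - (a + 1) + \<mu> * d - (a + 1) / a"
    if a: "0 < a" and b1: "b < 1" and \<mu>: "\<mu> < - K"
  proof -
    have "b / a < K"
      using a b by (simp add: K_def divide_simps)
    then show neg: "\<mu> + b / a < 0" using \<mu> by simp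
    have "0 < K" using a b by (simp add: K_def)
    then have "\<mu> * a < 0" using a \<mu> by (simp add: mult_neg_pos)
    then show "b + \<mu> * a < 1" using b1 by simp
    have "- K * d = (a + 2) * (- d * b) / (a * (a + 1))"
      by (simp add: K_def mult_ac)
    note Kd = this[unfolded det]
    have "- K * d < \<mu> * d" by (rule mult_strict_right_mono_neg[OF \<mu> d])
    \<comment> \<open>After clearing denominators this holds because
      \<open>(a + 2) * (1 + a + a\<^sup>2)\<close> exceeds \<open>(a + 1) ^ 3\<close> by exactly
      1.\<close>
    moreover have "(a + 1)\<^sup>2 / a < - K * d"
      unfolding Kd using a add_pos_pos[of a "a * a"]
      by (simp add: divide_simps algebra_simps power2_eq_square)
    \<comment> \<open>Hence \<open>\<mu> * d\<close> exceeds both subtracted terms together: the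
      second-iteration entry of column 3 is positive, while that of column 2 is negative.\<close>
    moreover have "(a + 1)\<^sup>2 / a = (a + 1) + (a + 1) / a"
      using a by (simp add: field_simps power2_eq_square)
    moreover have "0 < (a + 1) / a" using a by simp
    ultimately show "a < \<mu> * d" "\<mu> + b / a < - (a + 1) + \<mu> * d - (a + 1) / a"
      using neg by linarith+
  qed
  show ?thesis
    using U1 U2 K rest unfolding K_def[symmetric] by blast
qed

text \<open>The interval for \<open>\<mu>\<close> is nonempty only if its upper bound lies above
  \<open>- 1\<close>.\<close>

lemma mu_bounds_imp_less:
  fixes a b \<mu> :: real
  assumes a: "0 < a" and \<mu>: "- 1 < \<mu>" "\<mu> < - (b * (a + 2) / (a * (a + 1)))"
  shows "b < a * ((a + 1) / (a + 2))"
proof -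
  have "b * (a + 2) / (a * (a + 1)) < 1" using \<mu> by simp
  then have "b * (a + 2) < a * (a + 1)" using a by (simp add: divide_less_eq)
  then show ?thesis using a by (simp add: less_divide_eq)
qed

section \<open>Combining the matrix equations with the inequalities\<close>

theorem proposition3:
  fixes N :: "real ^ 4 ^ 2" and c :: "real ^ 4"
    and M1 :: tableau and A :: "real ^ 2 ^ 2" and \<mu> :: real
    and col :: "nat \<Rightarrow> tableau \<Rightarrow> 6"
  assumes "most_negative_rule col"
    and "M1 = initial_tableau N c"
    and "A = vector [vector [M1 $ 1 $ 1, M1 $ 1 $ 2], vector [M1 $ 2 $ 1, M1 $ 2 $ 2]]"
    and "M1 $ 3 $ 1 = -1" and "M1 $ 3 $ 2 = \<mu>"
    and "A $ 2 $ 1 < 0" and "0 < A $ 1 $ 2"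
  shows "(has_2_6_cycle_pattern col N c \<and> cycles_indefinitely col N c \<longleftrightarrow>
      (M1 = vector
         [vector [A $ 1 $ 1, A $ 1 $ 2, - (A $ 1 $ 1 + 1), - (A $ 1 $ 2), 1, 0],
          vector [A $ 2 $ 1, - (A $ 1 $ 1 + 1), - (A $ 2 $ 1), A $ 1 $ 1, 0, 1],
          vector [-1, \<mu>, - (A $ 1 $ 1 + 1) + \<mu> * A $ 2 $ 1,
                  - (A $ 1 $ 2) - \<mu> * A $ 1 $ 1, 0, 0]]
        \<and> - (A $ 2 $ 1) * A $ 1 $ 2 = 1 + A $ 1 $ 1 + (A $ 1 $ 1)\<^sup>2) \<and>
      (0 < A $ 1 $ 1 \<and> 0 < A $ 1 $ 2 \<and> A $ 1 $ 2 < 1) \<and>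
      (-1 < \<mu> \<and> \<mu> < - (A $ 1 $ 2 * (A $ 1 $ 1 + 2) / (A $ 1 $ 1 * (A $ 1 $ 1 + 1)))))
    \<and> (0 < A $ 1 $ 1 \<and> 0 < A $ 1 $ 2 \<and> A $ 1 $ 2 < 1 \<longrightarrow>
       -1 < \<mu> \<and> \<mu> < - (A $ 1 $ 2 * (A $ 1 $ 1 + 2) / (A $ 1 $ 1 * (A $ 1 $ 1 + 1))) \<longrightarrow>
       A $ 1 $ 2 < A $ 1 $ 1 * ((A $ 1 $ 1 + 1) / (A $ 1 $ 1 + 2)))"
proof -
  define a b d e where "a = A $ 1 $ 1" and "b = A $ 1 $ 2" and "d = A $ 2 $ 1" and "e = A $ 2 $ 2"
  define p q r s v w where "p = M1 $ 1 $ 3" and "q = M1 $ 1 $ 4" and "r = M1 $ 2 $ 3"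
    and "s = M1 $ 2 $ 4" and "v = M1 $ 3 $ 3" and "w = M1 $ 3 $ 4"
  note defs = a_def b_def d_def e_def p_def q_def r_def s_def v_def w_def
  have M1: "M1 = vector [vector [a, b, p, q, 1, 0], vector [d, e, r, s, 0, 1],
      vector [-1, \<mu>, v, w, 0, 0]]"
    using assms(2-5)
    by (simp add: defs vec_eq_iff forall_3 forall_6 initial_tableau_def vector_6)
  have b: "0 < b" and d: "d < 0" using assms(6,7) by (simp_all add: defs)
  let ?C = "vector [vector [a, b, - (a + 1), - b, 1, 0], vector [d, - (a + 1), - d, a, 0, 1],
      vector [-1, \<mu>, - (a + 1) + \<mu> * d, - b - \<mu> * a, 0, 0]] :: tableau"
  let ?U = "unique_pivot M1 1 1 \<and> unique_pivot (pivot M1 1 1) 2 2"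
  have C: "M1 = ?C \<longleftrightarrow> p = - (a + 1) \<and> q = - b \<and> e = - (a + 1) \<and> r = - d \<and> s = a \<and>
      v = - (a + 1) + \<mu> * d \<and> w = - b - \<mu> * a"
    unfolding M1 by (auto simp: vec_eq_iff forall_3 forall_6 vector_6)
  have shift: "pivot (pivot M1 1 1) 2 2 = shift_columns 2 M1 \<longleftrightarrow> M1 = ?C \<and> - d * b = 1 + a + a\<^sup>2"
    if "a \<noteq> 0" "e - d * b / a \<noteq> 0"
    using two_pivots_eq_shift_columns_iff[of a b e d p q r s \<mu> v w] that b C unfolding M1 by auto
  \<comment> \<open>The algebra requires nonzero pivot elements. Selected pivots are positive, which
    settles one direction; in the other, \<open>nz'\<close> finds the second pivot element to be
    \<open>1 / a\<close>.\<close>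
  have nz: "a \<noteq> 0" "e - d * b / a \<noteq> 0" if ?U
    using that d by (auto simp: M1 unique_pivot_def pivot_def vector_6)
  have nz': "e - d * b / a \<noteq> 0" if "M1 = ?C" "- d * b = 1 + a + a\<^sup>2" "0 < a"
  proof -
    have "e = - (a + 1)" using that(1) C by simp
    then show ?thesis using second_pivot_element[OF _ that(2)] that(3) by simp
  qed
  have U: "?U \<longleftrightarrow> 0 < a \<and> b < 1 \<and> - 1 < \<mu> \<and> \<mu> < - (b * (a + 2) / (a * (a + 1)))"
    if "M1 = ?C" "- d * b = 1 + a + a\<^sup>2"
    using unique_pivots_iff[OF b d that(2), of \<mu>] that(1) by simp
  have "has_2_6_cycle_pattern col N c \<and> cycles_indefinitely col N c \<longleftrightarrow>
      ?U \<and> pivot (pivot M1 1 1) 2 2 = shift_columns 2 M1"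
    using has_2_6_cycle_pattern_iff[OF assms(1), of N c]
      has_2_6_cycle_pattern_imp_cycles[OF assms(1), of N c] assms(2) by auto
  also have "\<dots> \<longleftrightarrow> (M1 = ?C \<and> - d * b = 1 + a + a\<^sup>2) \<and>
      (0 < a \<and> 0 < b \<and> b < 1) \<and> - 1 < \<mu> \<and> \<mu> < - (b * (a + 2) / (a * (a + 1)))"
    using shift nz nz' U b by (metis less_irrefl)
  finally have "has_2_6_cycle_pattern col N c \<and> cycles_indefinitely col N c \<longleftrightarrow>
      (M1 = ?C \<and> - d * b = 1 + a + a\<^sup>2) \<and>
      (0 < a \<and> 0 < b \<and> b < 1) \<and> - 1 < \<mu> \<and> \<mu> < - (b * (a + 2) / (a * (a + 1)))" .
  then show ?thesis
    using mu_bounds_imp_less[of a \<mu> b] unfolding a_def b_def d_def by blast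
qed

end
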